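(* Let $H=H_{\tau}$, $\tau\in I$ ($I\subseteq\mathbb{R}$ an open interval), be an analytic one-parameter family of self-adjoint operators on a Hilbert space $(\mathcal{H},\langle\cdot,\cdot\rangle)$ with common domain $\mathcal{D}_H$, having purely discrete spectrum consisting of eigenvalues $\lambda_j=\lambda_j(\tau)$, $j=1,2,\dots$, analytic in $\tau$, with corresponding eigenvectors $u_j=u_j(\tau)$ forming a complete orthonormal basis of $\mathcal{H}$. Let $G_{\alpha}$, $\alpha=1,\dots,d$, be a family of linear operators with adjoints $G_{\alpha}^*$ such that all first and second commutators with $H$ are well-defined. Suppose that for all $j$ (and all $\tau$) $$\frac12\sum_{\alpha=1}^d\Big(\langle[G_{\alpha}^*,[H,G_{\alpha}]]u_j,u_j\rangle+\langle[G_{\alpha},[H,G_{\alpha}^*]]u_j,u_j\rangle\Big)=1$$ and $$\sum_{\alpha=1}^d\Big(\langle[H,G_{\alpha}]u_j,[H,G_{\alpha}]u_j\rangle+\langle[H,G_{\alpha}^*]u_j,[H,G_{\alpha}^*]u_j\rangle\Big)\leq \eta(\tau)\lambda_j+\theta(\tau)\dot{\lambda}_j,$$ where $\eta,\theta$ are continuous functions of $\tau$ with $1+\eta>0$ and $\theta\neq 0$. Let $A(\tau),B(\tau)$ be positive solutions of $$\dot{A}=-\frac{1+\eta}{\theta}\,A,\qquad \dot{B}=-\frac{\eta}{\theta}\,B.$$ Then for all $z\in\mathbb{R}$ the quantity $$A(\tau)^{-2}\sum_j\big(zB(\tau)-\lambda_j(\tau)\big)_{+}^2$$ is non-increasing in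 $\tau$ if $\theta>0$ and non-decreasing in $\tau$ if $\theta<0$.
   Context: A dot denotes $d/d\tau$; $x_+=\max(x,0)$; $[X,Y]=XY-YX$. "Analytic family with common domain" means that each $H_\tau$ is self-adjoint on the same domain $\mathcal{D}_H$ and $\tau\mapsto H_\tau\psi$ is real analytic for every $\psi\in\mathcal{D}_H$. The eigenvalues are repeated according to (finite) multiplicity; for each $\tau$ the spectrum can be listed in increasing order, i.e. it is bounded below and the eigenvalues accumulate only at $+\infty$, so that the sum is finite. "Well-defined commutators" means that the first and second commutators in the hypotheses make sense when applied to the eigenvectors $u_j$ (for instance, $G_\alpha$ and $G_\alpha^*$ are bounded and map $\mathcal{D}_H$ into itself). *)

theory Defs
  imports "HOL-Analysis.Analysis"
begin

text \<open>
  Complex Hilbert spaces. The norm, the topology and completeness are those of the library class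
  \<^class>\<open>banach\<close>. The inner product is linear in its first argument.
\<close>

class chilbert_space = banach +
  fixes scaleC :: "complex \<Rightarrow> 'a \<Rightarrow> 'a"  (infixr "*\<^sub>C" 75)
    and cinner :: "'a \<Rightarrow> 'a \<Rightarrow> complex"
  assumes scaleC_add_right: "a *\<^sub>C (x + y) = a *\<^sub>C x + a *\<^sub>C y"
    and scaleC_add_left: "(a + b) *\<^sub>C x = a *\<^sub>C x + b *\<^sub>C x"
    and scaleC_scaleC: "a *\<^sub>C (b *\<^sub>C x) = (a * b) *\<^sub>C x"
    and scaleC_one: "1 *\<^sub>C x = x"
    and scaleR_scaleC: "r *\<^sub>R x = complex_of_real r *\<^sub>C x"
    and cinner_commute: "cinner x y = cnj (cinner y x)"
    and cinner_add_left: "cinner (x + y) z = cinner x z + cinner y z"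
    and cinner_scaleC_left: "cinner (a *\<^sub>C x) y = a * cinner x y"
    and cinner_self: "cinner x x = complex_of_real ((norm x)\<^sup>2)"

lemma vector_space_scaleC:
  "vector_space (scaleC :: complex \<Rightarrow> 'a \<Rightarrow> 'a::chilbert_space)"
  by unfold_locales (auto simp: scaleC_add_right scaleC_add_left scaleC_scaleC scaleC_one)

abbreviation csubspace :: "'a::chilbert_space set \<Rightarrow> bool" where
  "csubspace \<equiv> module.subspace scaleC"

abbreviation cspan :: "'a::chilbert_space set \<Rightarrow> 'a set" where
  "cspan \<equiv> module.span scaleC"

definition complete_orthonormal :: "('i \<Rightarrow> 'a::chilbert_space) \<Rightarrow> bool" where
  "complete_orthonormal u \<longleftrightarrow>
     (\<forall>i j. cinner (u i) (u j) = (if i = j then 1 else 0)) \<and>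
     closure (cspan (range u)) = UNIV"

text \<open>
  A possibly unbounded operator is a domain together with a function. The values of the function
  outside the domain are irrelevant.
\<close>

datatype 'a lop = Lop (op_dom: "'a set") (op_app: "'a \<Rightarrow> 'a")

definition linear_op :: "'a::chilbert_space lop \<Rightarrow> bool" where
  "linear_op T \<longleftrightarrow> csubspace (op_dom T) \<and>
     (\<forall>x\<in>op_dom T. \<forall>y\<in>op_dom T. op_app T (x + y) = op_app T x + op_app T y) \<and>
     (\<forall>a. \<forall>x\<in>op_dom T. op_app T (a *\<^sub>C x) = a *\<^sub>C op_app T x)"

definition densely_defined :: "'a::chilbert_space lop \<Rightarrow> bool" where
  "densely_defined T \<longleftrightarrow> closure (op_dom T) = UNIV"

text \<open>
  The Hilbert space adjoint. The vector described by \<open>THE\<close> is unique only for densely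
  defined \<open>T\<close>.
\<close>

definition op_adjoint :: "'a::chilbert_space lop \<Rightarrow> 'a lop" where
  "op_adjoint T = Lop
     {y. \<exists>z. \<forall>x\<in>op_dom T. cinner (op_app T x) y = cinner x z}
     (\<lambda>y. THE z. \<forall>x\<in>op_dom T. cinner (op_app T x) y = cinner x z)"

definition self_adjoint :: "'a::chilbert_space lop \<Rightarrow> bool" where
  "self_adjoint T \<longleftrightarrow> linear_op T \<and> densely_defined T \<and>
     op_dom (op_adjoint T) = op_dom T \<and>
     (\<forall>x\<in>op_dom T. op_app (op_adjoint T) x = op_app T x)"

text \<open>
  The commutator \<open>X Y - Y X\<close> on its natural domain, on which every product is defined.
\<close>

definition op_comp :: "'a lop \<Rightarrow> 'a lop \<Rightarrow> 'a lop" where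
  "op_comp X Y = Lop {x \<in> op_dom Y. op_app Y x \<in> op_dom X} (\<lambda>x. op_app X (op_app Y x))"

definition op_diff :: "'a::chilbert_space lop \<Rightarrow> 'a lop \<Rightarrow> 'a lop" where
  "op_diff X Y = Lop (op_dom X \<inter> op_dom Y) (\<lambda>x. op_app X x - op_app Y x)"

definition commutator :: "'a::chilbert_space lop \<Rightarrow> 'a lop \<Rightarrow> 'a lop" where
  "commutator X Y = op_diff (op_comp X Y) (op_comp Y X)"

definition resolvent_set :: "'a::chilbert_space lop \<Rightarrow> complex set" where
  "resolvent_set T = {z.
     bij_betw (\<lambda>x. op_app T x - z *\<^sub>C x) (op_dom T) UNIV \<and>
     (\<exists>C. \<forall>x\<in>op_dom T. norm x \<le> C * norm (op_app T x - z *\<^sub>C x))}"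

definition op_spectrum :: "'a::chilbert_space lop \<Rightarrow> complex set" where
  "op_spectrum T = - resolvent_set T"

definition eigenspace :: "'a::chilbert_space lop \<Rightarrow> complex \<Rightarrow> 'a set" where
  "eigenspace T z = {x \<in> op_dom T. op_app T x = z *\<^sub>C x}"

definition purely_discrete_spectrum :: "'a::chilbert_space lop \<Rightarrow> bool" where
  "purely_discrete_spectrum T \<longleftrightarrow> (\<forall>z\<in>op_spectrum T.
     z isolated_in op_spectrum T \<and>
     eigenspace T z \<noteq> {0} \<and>
     (\<exists>S. finite S \<and> eigenspace T z \<subseteq> cspan S))"

definition real_analytic_on :: "(real \<Rightarrow> 'a::real_normed_vector) \<Rightarrow> real set \<Rightarrow> bool" where
  "real_analytic_on f S \<longleftrightarrow> (\<forall>t0\<in>S. \<exists>r>0. \<exists>c :: nat \<Rightarrow> 'a.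
     \<forall>t\<in>S. \<bar>t - t0\<bar> < r \<longrightarrow> (\<lambda>n. (t - t0) ^ n *\<^sub>R c n) sums f t)"

definition analytic_family_common_domain ::
    "(real \<Rightarrow> 'a::chilbert_space lop) \<Rightarrow> 'a set \<Rightarrow> real set \<Rightarrow> bool" where
  "analytic_family_common_domain H D I \<longleftrightarrow>
     (\<forall>\<tau>\<in>I. self_adjoint (H \<tau>) \<and> op_dom (H \<tau>) = D) \<and>
     (\<forall>\<psi>\<in>D. real_analytic_on (\<lambda>\<tau>. op_app (H \<tau>) \<psi>) I)"

text \<open>
  All first and second commutators with \<open>H\<close> can be applied to \<open>u\<close>. This covers bounded,
  everywhere defined \<open>G\<close> and \<open>G\<^sup>*\<close> that map the domain of \<open>H\<close> into itself.
\<close>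

definition commutators_defined_at ::
    "'a::chilbert_space lop \<Rightarrow> 'a lop \<Rightarrow> 'a \<Rightarrow> bool" where
  "commutators_defined_at H G u \<longleftrightarrow>
     u \<in> op_dom (commutator H G) \<and>
     u \<in> op_dom (commutator H (op_adjoint G)) \<and>
     u \<in> op_dom (commutator (op_adjoint G) (commutator H G)) \<and>
     u \<in> op_dom (commutator G (commutator H (op_adjoint G)))"

end

theory Submission
  imports Defs
begin

text \<open>
  With the symmetric weights
  \<open>w j k = \<Sum>\<alpha>. \<bar>\<langle>G\<^sub>\<alpha> u\<^sub>j, u\<^sub>k\<rangle>\<bar>\<^sup>2 + \<bar>\<langle>G\<^sub>\<alpha> u\<^sub>k, u\<^sub>j\<rangle>\<bar>\<^sup>2\<close>,
  Parseval's identity turns the commutator hypotheses into \<open>\<Sum>k. (\<lambda>\<^sub>k - \<lambda>\<^sub>j) w j k = 1\<close> and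
  \<open>\<Sum>k. (\<lambda>\<^sub>k - \<lambda>\<^sub>j)\<^sup>2 w j k \<le> \<eta> \<lambda>\<^sub>j + \<theta> \<lambda>\<^sub>j'\<close>. Symmetrizing in \<open>j, k\<close> gives the trace inequality
  \<open>\<Sum>j. (c - \<lambda>\<^sub>j)\<^sub>+\<^sup>2 \<le> \<Sum>j. (c - \<lambda>\<^sub>j)\<^sub>+ (\<eta> \<lambda>\<^sub>j + \<theta> \<lambda>\<^sub>j')\<close>, which at \<open>c = z B\<close> is the sign of the
  derivative of the Riesz mean. Differentiation under the sum is harmless: the second hypothesis
  also says that \<open>\<eta> \<lambda>\<^sub>j + \<theta> \<lambda>\<^sub>j' \<ge> 0\<close>, so every \<open>\<lambda>\<^sub>j / B\<close> is monotone in the same direction, and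
  on a compact interval the finitely many indices that contribute at one endpoint
  include all those that contribute anywhere in it.
\<close>

section \<open>Elementary inner product algebra and density\<close>

lemma cinner_add_right: "cinner x (y + z) = cinner x y + cinner x (z::'a::chilbert_space)"
  by (metis cinner_add_left cinner_commute complex_cnj_add)

lemma cinner_scaleC_right: "cinner x (a *\<^sub>C y) = cnj a * cinner x (y::'a::chilbert_space)"
  by (metis cinner_commute cinner_scaleC_left complex_cnj_mult)

lemma cinner_zero_left [simp]: "cinner 0 (y::'a::chilbert_space) = 0"
  using cinner_add_left[of 0 0 y] by simp

lemma cinner_zero_right [simp]: "cinner (y::'a::chilbert_space) 0 = 0"
  using cinner_add_right[of y 0 0] by simp

lemma cinner_diff_left: "cinner (x - y) z = cinner x z - cinner y (z::'a::chilbert_space)"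
  using cinner_add_left[of "x - y" y z] by simp

lemma cinner_diff_right: "cinner z (x - y) = cinner z x - cinner z (y::'a::chilbert_space)"
  using cinner_add_right[of z "x - y" y] by simp

lemma cinner_sum_left: "cinner (\<Sum>i\<in>S. f i) (y::'a::chilbert_space) = (\<Sum>i\<in>S. cinner (f i) y)"
  by (induction S rule: infinite_finite_induct) (auto simp: cinner_add_left)

lemma cinner_sum_right: "cinner (y::'a::chilbert_space) (\<Sum>i\<in>S. f i) = (\<Sum>i\<in>S. cinner y (f i))"
  by (induction S rule: infinite_finite_induct) (auto simp: cinner_add_right)

text \<open>The difference of \<open>x\<close> and its orthogonal projection onto the line through
  \<open>y\<close> has nonnegative squared norm.\<close>

lemma cinner_Cauchy_Schwarz: "cmod (cinner x y) \<le> norm x * norm (y::'a::chilbert_space)"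
proof (cases "y = 0")
  case False
  define n where "n = (norm y)\<^sup>2"
  have n: "n > 0" using False by (simp add: n_def)
  define a where "a = cinner x y / complex_of_real n"
  have yy: "cinner y y = complex_of_real n"
    by (simp add: n_def cinner_self)
  have yx: "cinner y x = cnj (cinner x y)" by (rule cinner_commute)
  have "complex_of_real ((norm (x - a *\<^sub>C y))\<^sup>2) = cinner (x - a *\<^sub>C y) (x - a *\<^sub>C y)"
    by (simp add: cinner_self)
  also have "\<dots> = cinner x x - cinner x y * cnj (cinner x y) / complex_of_real n"
    using n
    by (simp add: cinner_diff_left cinner_diff_right cinner_scaleC_left cinner_scaleC_right
        yy yx a_def field_simps)
  also have "\<dots> = complex_of_real ((norm x)\<^sup>2 - (cmod (cinner x y))\<^sup>2 / n)"
    by (simp add: cinner_self complex_norm_square[symmetric] del: of_real_power flip: of_real_diff of_real_divide)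
  finally have "(norm (x - a *\<^sub>C y))\<^sup>2 = (norm x)\<^sup>2 - (cmod (cinner x y))\<^sup>2 / n"
    using of_real_eq_iff by blast
  then have "(cmod (cinner x y))\<^sup>2 / n \<le> (norm x)\<^sup>2"
    by (metis diff_ge_0_iff_ge zero_le_power2)
  then have "(cmod (cinner x y))\<^sup>2 \<le> (norm x * norm y)\<^sup>2"
    using n by (simp add: n_def divide_le_eq power_mult_distrib)
  then show ?thesis by (simp add: power2_le_iff_abs_le)
qed simp

lemma bounded_linear_cinner_left: "bounded_linear (\<lambda>x. cinner x (y::'a::chilbert_space))"
proof (rule bounded_linear_intro[where K = "norm y"])
  show "cinner (r *\<^sub>R x) y = r *\<^sub>R cinner x y" for r and x :: 'a
    by (simp add: scaleR_scaleC cinner_scaleC_left scaleR_conv_of_real)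
qed (auto simp: cinner_add_left cinner_Cauchy_Schwarz)

text \<open>Pairing with \<open>y - z\<close> is continuous and vanishes on \<open>S\<close>, hence
  everywhere, in particular at \<open>y - z\<close> itself. This settles uniqueness questions about
  adjoints.\<close>

lemma dense_cinner_eqI:
  fixes y z :: "'a::chilbert_space"
  assumes "closure S = UNIV" and "\<And>x. x \<in> S \<Longrightarrow> cinner x y = cinner x z"
  shows "y = z"
proof -
  have cont: "continuous_on UNIV (\<lambda>x. cinner x (y - z))"
    by (intro linear_continuous_on bounded_linear_cinner_left)
  have "cinner x (y - z) = 0" for x
    by (rule continuous_constant_on_closure[of S "\<lambda>x. cinner x (y - z)" 0 x])
      (use assms cont in \<open>auto simp: cinner_diff_right\<close>)
  from this[of "y - z"] show ?thesis by (simp add: cinner_self)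
qed

section \<open>Adjoints\<close>

text \<open>Density makes the vector behind \<open>THE\<close> in \<open>op_adjoint\<close> unique,
  so its defining relation becomes available.\<close>

lemma op_adjoint_cinner:
  assumes T: "densely_defined T" and x: "x \<in> op_dom T" and y: "y \<in> op_dom (op_adjoint T)"
  shows "cinner (op_app T x) y = cinner x (op_app (op_adjoint T) y)"
proof -
  have ex: "\<exists>z. \<forall>x\<in>op_dom T. cinner (op_app T x) y = cinner x z"
    using y by (simp add: op_adjoint_def)
  have "\<exists>!z. \<forall>x\<in>op_dom T. cinner (op_app T x) y = cinner x z"
  proof (rule ex_ex1I[OF ex])
    fix z z' assume "\<forall>x\<in>op_dom T. cinner (op_app T x) y = cinner x z"
      "\<forall>x\<in>op_dom T. cinner (op_app T x) y = cinner x z'"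
    then show "z = z'"
      using T dense_cinner_eqI[of "op_dom T" z z'] by (auto simp: densely_defined_def)
  qed
  from theI'[OF this] x show ?thesis by (simp add: op_adjoint_def)
qed

text \<open>Both sides have the same inner products with the dense domain of \<open>T\<close>. It is
  applied at an eigenvector, whose multiple by the eigenvalue lies in the domain of the adjoint by
  the commutator conditions.\<close>

lemma op_adjoint_scaleC:
  assumes T: "densely_defined T" and y: "y \<in> op_dom (op_adjoint T)"
    and ay: "a *\<^sub>C y \<in> op_dom (op_adjoint T)"
  shows "op_app (op_adjoint T) (a *\<^sub>C y) = a *\<^sub>C op_app (op_adjoint T) y"
proof (rule dense_cinner_eqI)
  show "closure (op_dom T) = UNIV" using T by (simp add: densely_defined_def)
  show "cinner x (op_app (op_adjoint T) (a *\<^sub>C y)) = cinner x (a *\<^sub>C op_app (op_adjoint T) y)"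
    if "x \<in> op_dom T" for x
    using op_adjoint_cinner[OF T that y] op_adjoint_cinner[OF T that ay]
    by (simp add: cinner_scaleC_right)
qed

lemma self_adjoint_cinner:
  assumes "self_adjoint T" "x \<in> op_dom T" "y \<in> op_dom T"
  shows "cinner (op_app T x) y = cinner x (op_app T y)"
  using assms op_adjoint_cinner[of T x y] by (simp add: self_adjoint_def)

section \<open>Orthonormal expansions and Parseval's identity\<close>

text \<open>The vectors to which their own partial sums converge form a subspace containing the
  basis. The partial sum maps are contractions, so convergence passes from the dense span to every
  vector.\<close>

lemma complete_orthonormal_expansion:
  fixes e :: "nat \<Rightarrow> 'a::chilbert_space"
  assumes "complete_orthonormal e"
  shows "(\<lambda>k. cinner x (e k) *\<^sub>C e k) sums x"
proof -
  interpret V: vector_space "scaleC :: complex \<Rightarrow> 'a \<Rightarrow> 'a" by (rule vector_space_scaleC)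
  have on: "cinner (e i) (e j) = (if i = j then 1 else 0)" for i j
    using assms by (simp add: complete_orthonormal_def)
  define P where "P N x = (\<Sum>k<N. cinner x (e k) *\<^sub>C e k)" for N x
  have P_add: "P N (x + y) = P N x + P N y" for N x y
    by (simp add: P_def cinner_add_left scaleC_add_left sum.distrib)
  have P_scale: "P N (a *\<^sub>C x) = a *\<^sub>C P N x" for N a x
    by (simp add: P_def cinner_scaleC_left V.scale_sum_right)
  have P_diff: "P N (x - y) = P N x - P N y" for N x y
    using P_add[of N "x - y" y] by simp
  have coeff: "cinner (P N x) (e k) = cinner x (e k)" if "k < N" for N x k
    using that by (simp add: P_def cinner_sum_left cinner_scaleC_left on if_distrib cong: if_cong)
  have P_le: "norm (P N x) \<le> norm x" for N x
  proof -
    have right: "cinner v (P N x) = (\<Sum>k<N. cnj (cinner x (e k)) * cinner v (e k))" for v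
      by (simp add: P_def cinner_sum_right cinner_scaleC_right)
    \<comment> \<open>The formula \<open>right\<close> sees only coefficients with index below
      \<open>N\<close>, and there \<open>P N x\<close> and \<open>x\<close> agree.\<close>
    have "cinner (P N x) (P N x) = cinner x (P N x)"
      unfolding right by (rule sum.cong) (auto simp: coeff)
    then have "(norm (P N x))\<^sup>2 = cmod (cinner x (P N x))"
      by (metis abs_power2 cinner_self norm_of_real)
    also have "\<dots> \<le> norm x * norm (P N x)" by (rule cinner_Cauchy_Schwarz)
    finally show ?thesis
      by (cases "norm (P N x) = 0") (auto simp: power2_eq_square)
  qed
  define W where "W = {x. (\<lambda>N. P N x) \<longlonglongrightarrow> x}"
  have "e j \<in> W" for j
  proof -
    have "P N (e j) = e j" if "N > j" for N
    proof -
      have "P N (e j) = (\<Sum>k<N. if j = k then e j else 0)"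
        unfolding P_def by (rule sum.cong) (auto simp: on scaleC_one)
      then show ?thesis using that by simp
    qed
    then have "eventually (\<lambda>N. P N (e j) = e j) sequentially"
      by (rule eventually_mono[OF eventually_gt_at_top])
    then show ?thesis unfolding W_def by (simp add: tendsto_eventually)
  qed
  moreover have "V.subspace W"
  proof (rule V.subspaceI)
    show "0 \<in> W" by (simp add: W_def P_def)
    show "x + y \<in> W" if "x \<in> W" "y \<in> W" for x y
      using that by (auto simp: W_def P_add intro: tendsto_add)
    show "a *\<^sub>C x \<in> W" if "x \<in> W" for a x
    proof -
      \<comment> \<open>The class \<open>banach\<close> gives homogeneity of the norm for real
        scalars; for complex scalars it follows from \<open>cinner_self\<close>.\<close>
      have norm_scale: "norm (a *\<^sub>C y) = cmod a * norm y" for y :: 'a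
      proof -
        have "complex_of_real ((norm (a *\<^sub>C y))\<^sup>2) = complex_of_real ((cmod a * norm y)\<^sup>2)"
          by (simp add: cinner_scaleC_left cinner_scaleC_right cinner_self[symmetric]
              power_mult_distrib complex_norm_square del: of_real_power)
        then have "(norm (a *\<^sub>C y))\<^sup>2 = (cmod a * norm y)\<^sup>2" using of_real_eq_iff by blast
        then show ?thesis by (simp add: power2_eq_iff_nonneg)
      qed
      have "(\<lambda>N. cmod a * norm (P N x - x)) \<longlonglongrightarrow> 0"
        using that by (intro tendsto_mult_right_zero tendsto_norm_zero LIM_zero) (simp add: W_def)
      then have "(\<lambda>N. norm (P N (a *\<^sub>C x) - a *\<^sub>C x)) \<longlonglongrightarrow> 0"
        by (simp only: P_scale norm_scale V.scale_right_diff_distrib[symmetric])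
      then have "(\<lambda>N. P N (a *\<^sub>C x) - a *\<^sub>C x) \<longlonglongrightarrow> 0"
        by (rule tendsto_norm_zero_cancel)
      then show ?thesis unfolding W_def by (blast intro: LIM_zero_cancel)
    qed
  qed
  ultimately have span: "cspan (range e) \<subseteq> W" by (intro V.span_minimal) auto
  have "(\<lambda>N. P N x) \<longlonglongrightarrow> x"
  proof (rule LIMSEQ_I)
    fix r :: real assume r: "r > 0"
    have "x \<in> closure (cspan (range e))" using assms by (simp add: complete_orthonormal_def)
    moreover have "r / 3 > 0" using r by simp
    ultimately obtain y where "y \<in> cspan (range e)" and yx: "dist y x < r / 3"
      unfolding closure_approachable by blast
    then have y: "y \<in> W" using span by blast
    then obtain N0 where N0: "norm (P N y - y) < r / 3" if "N \<ge> N0" for N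
      using LIMSEQ_D[of "\<lambda>N. P N y" y "r / 3"] y r by (auto simp: W_def)
    have "norm (P N x - x) < r" if "N \<ge> N0" for N
    proof -
      \<comment> \<open>Each of the three terms is below \<open>r / 3\<close>: the first by
        contraction, uniformly in \<open>N\<close>, the second by convergence at \<open>y\<close>,
        the third by the choice of \<open>y\<close>.\<close>
      have "P N x - x = P N (x - y) + (P N y - y) + (y - x)" by (simp add: P_diff)
      then have "norm (P N x - x) = norm (P N (x - y) + (P N y - y) + (y - x))"
        by (rule arg_cong)
      then have "norm (P N x - x) \<le> norm (P N (x - y)) + norm (P N y - y) + norm (y - x)"
        using norm_triangle_ineq[of "P N (x - y) + (P N y - y)" "y - x"]
          norm_triangle_ineq[of "P N (x - y)" "P N y - y"] by linarith
      then show ?thesis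
        using P_le[of N "x - y"] N0[OF that] yx by (simp add: dist_norm norm_minus_commute)
    qed
    then show "\<exists>N0. \<forall>N\<ge>N0. norm (P N x - x) < r" by blast
  qed
  then show ?thesis by (simp add: sums_def P_def)
qed

lemma Parseval:
  fixes e :: "nat \<Rightarrow> 'a::chilbert_space"
  assumes "complete_orthonormal e"
  shows "(\<lambda>k. cinner x (e k) * cnj (cinner y (e k))) sums cinner x y"
proof -
  have "(\<lambda>k. cinner (cinner x (e k) *\<^sub>C e k) y) sums cinner x y"
    by (rule bounded_linear.sums[OF bounded_linear_cinner_left])
      (rule complete_orthonormal_expansion[OF assms])
  then show ?thesis
    by (simp add: cinner_scaleC_left cinner_commute[of "e _" y])
qed

section \<open>Commutators in an eigenbasis\<close>

lemma op_dom_commutator: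
  "x \<in> op_dom (commutator X Y) \<longleftrightarrow>
     x \<in> op_dom X \<and> x \<in> op_dom Y \<and> op_app Y x \<in> op_dom X \<and> op_app X x \<in> op_dom Y"
  by (auto simp: commutator_def op_diff_def op_comp_def)

lemma op_app_commutator:
  "op_app (commutator X Y) x = op_app X (op_app Y x) - op_app Y (op_app X x)"
  by (simp add: commutator_def op_diff_def op_comp_def)

text \<open>The coefficients of \<open>c\<close> are those of \<open>X (e j)\<close> multiplied by
  \<open>l k - l j\<close>, so Parseval gives the first series. For the second, moving operators
  across the inner product leaves quadratic forms in \<open>X (e j)\<close> and
  \<open>Y (e j)\<close>. Only the pairing \<open>adj\<close> and the homogeneity \<open>hom\<close>
  tie \<open>X\<close> and \<open>Y\<close> together, so the roles of an operator and its adjoint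
  can be exchanged.\<close>

lemma commutator_sums:
  fixes H X Y :: "'a::chilbert_space lop" and e :: "nat \<Rightarrow> 'a" and l :: "nat \<Rightarrow> real"
  assumes sym: "\<And>x y. x \<in> op_dom H \<Longrightarrow> y \<in> op_dom H \<Longrightarrow>
      cinner (op_app H x) y = cinner x (op_app H y)"
    and e: "complete_orthonormal e"
    and eig: "\<And>k. e k \<in> op_dom H" "\<And>k. op_app H (e k) = complex_of_real (l k) *\<^sub>C e k"
    and adj: "\<And>x y. x \<in> op_dom X \<Longrightarrow> y \<in> op_dom Y \<Longrightarrow>
      cinner (op_app X x) y = cinner x (op_app Y y)"
    and hom: "op_app X (complex_of_real (l j) *\<^sub>C e j) = complex_of_real (l j) *\<^sub>C op_app X (e j)"
    and dom: "e j \<in> op_dom (commutator Y (commutator H X))"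
  defines "c \<equiv> op_app (commutator H X) (e j)"
  shows first_commutator_sums:
      "(\<lambda>k. (l k - l j)\<^sup>2 * (cmod (cinner (op_app X (e j)) (e k)))\<^sup>2) sums Re (cinner c c)"
    and second_commutator_sums:
      "(\<lambda>k. (l k - l j) * ((cmod (cinner (op_app X (e j)) (e k)))\<^sup>2
                        + (cmod (cinner (op_app Y (e j)) (e k)))\<^sup>2))
        sums Re (cinner (op_app (commutator Y (commutator H X)) (e j)) (e j))"
proof -
  define x y where "x = op_app X (e j)" and "y = op_app Y (e j)"
  have d: "e j \<in> op_dom X" "e j \<in> op_dom Y" "x \<in> op_dom H" "c \<in> op_dom Y"
    "y \<in> op_dom X" "op_app X y \<in> op_dom H" "y \<in> op_dom H" "op_app H y \<in> op_dom X"
    using dom by (auto simp: op_dom_commutator x_def y_def c_def)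
  have H_coeff: "cinner (op_app H v) (e k) = complex_of_real (l k) * cinner v (e k)"
    if "v \<in> op_dom H" for v k
    using sym[OF that eig(1)] by (simp add: eig cinner_scaleC_right)
  have c_eq: "c = op_app H x - complex_of_real (l j) *\<^sub>C x"
    by (simp add: c_def op_app_commutator eig(2) hom x_def)
  have coeff: "cinner c (e k) = complex_of_real (l k - l j) * cinner x (e k)" for k
    by (simp add: c_eq cinner_diff_left cinner_scaleC_left H_coeff[OF d(3)] algebra_simps)
  have "(\<lambda>k. Re (cinner c (e k) * cnj (cinner c (e k)))) sums Re (cinner c c)"
    by (intro sums_Re Parseval e)
  moreover have "Re (cinner c (e k) * cnj (cinner c (e k))) = (l k - l j)\<^sup>2 * (cmod (cinner x (e k)))\<^sup>2" for k
    by (subst complex_norm_square[symmetric])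
      (simp add: coeff norm_mult power_mult_distrib del: of_real_diff)
  ultimately show "(\<lambda>k. (l k - l j)\<^sup>2 * (cmod (cinner (op_app X (e j)) (e k)))\<^sup>2) sums Re (cinner c c)"
    by (simp add: x_def)
  have "(\<lambda>k. Re (cinner c (e k) * cnj (cinner x (e k)))) sums Re (cinner c x)"
    by (intro sums_Re Parseval e)
  moreover have "Re (cinner c (e k) * cnj (cinner x (e k))) = (l k - l j) * (cmod (cinner x (e k)))\<^sup>2" for k
    by (simp add: coeff mult.assoc complex_norm_square[symmetric] del: of_real_diff of_real_power)
  ultimately have 1: "(\<lambda>k. (l k - l j) * (cmod (cinner x (e k)))\<^sup>2) sums Re (cinner c x)"
    by simp
  \<comment> \<open>Since \<open>y\<close> lies in the domain of \<open>H\<close>, the series for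
    \<open>cinner (op_app H y) y\<close> and for \<open>cinner y y\<close> converge separately and
    can be combined into one with factor \<open>l k - l j\<close>.\<close>
  have "(\<lambda>k. Re (cinner (op_app H y) (e k) * cnj (cinner y (e k)))) sums Re (cinner (op_app H y) y)"
    by (intro sums_Re Parseval e)
  moreover have "Re (cinner (op_app H y) (e k) * cnj (cinner y (e k))) = l k * (cmod (cinner y (e k)))\<^sup>2" for k
    by (simp add: H_coeff[OF d(7)] mult.assoc complex_norm_square[symmetric] del: of_real_power)
  ultimately have 2: "(\<lambda>k. l k * (cmod (cinner y (e k)))\<^sup>2) sums Re (cinner (op_app H y) y)"
    by simp
  have "(\<lambda>k. Re (cinner y (e k) * cnj (cinner y (e k)))) sums Re (cinner y y)"
    by (intro sums_Re Parseval e)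
  then have 3: "(\<lambda>k. (cmod (cinner y (e k)))\<^sup>2) sums Re (cinner y y)"
    by (simp add: complex_norm_square[symmetric] del: of_real_power)
  have "cinner (op_app Y c) (e j) = cinner c x"
    using adj[OF d(1,4)] by (metis cinner_commute x_def)
  \<comment> \<open>In \<open>H X y - X H y\<close>, symmetry of \<open>H\<close> extracts
    \<open>l j\<close> from the first term, and \<open>adj\<close> then turns \<open>X\<close> into
    \<open>Y\<close> acting on \<open>e j\<close>, which is \<open>y\<close> again.\<close>
  moreover have "cinner (op_app (commutator H X) y) (e j) =
      complex_of_real (l j) * cinner y y - cinner (op_app H y) y"
    using adj[OF d(5,2)] adj[OF d(8,2)]
    by (simp add: op_app_commutator cinner_diff_left H_coeff[OF d(6)] flip: y_def)
  ultimately have second: "Re (cinner (op_app (commutator Y (commutator H X)) (e j)) (e j)) =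
      Re (cinner c x) + (Re (cinner (op_app H y) y) - l j * Re (cinner y y))"
    unfolding op_app_commutator[of Y]
    by (simp add: cinner_diff_left c_def y_def)
  show "(\<lambda>k. (l k - l j) * ((cmod (cinner (op_app X (e j)) (e k)))\<^sup>2
                        + (cmod (cinner (op_app Y (e j)) (e k)))\<^sup>2))
        sums Re (cinner (op_app (commutator Y (commutator H X)) (e j)) (e j))"
    unfolding second
    using sums_add[OF 1 sums_diff[OF 2 sums_mult[OF 3, of "l j"]]]
    by (simp add: algebra_simps x_def y_def)
qed

section \<open>Spectral sums with symmetric weights\<close>

text \<open>
  The trace inequality of Harrell and Stubbe. The terms with \<open>l j, l k < z\<close> agree on both sides
  after symmetrizing in \<open>j, k\<close>; for \<open>l j < z \<le> l k\<close> the termwise inequality holds because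
  \<open>z - l j \<le> l k - l j\<close>.
\<close>

lemma symmetric_weights_trace_inequality:
  fixes l F :: "nat \<Rightarrow> real" and w :: "nat \<Rightarrow> nat \<Rightarrow> real" and z :: real
  assumes fin: "finite {j. l j < z}"
    and sym: "\<And>j k. w j k = w k j" and nn: "\<And>j k. w j k \<ge> 0"
    and S: "\<And>j. (\<lambda>k. (l k - l j) * w j k) sums 1"
    and F: "\<And>j. (\<lambda>k. (l k - l j)\<^sup>2 * w j k) sums F j"
  shows "(\<Sum>j | l j < z. (z - l j)\<^sup>2) \<le> (\<Sum>j | l j < z. (z - l j) * F j)"
proof -
  define J where "J = {j. l j < z}"
  \<comment> \<open>Summed over \<open>k\<close>, these terms give the difference of the two sides
    of the claim at index \<open>j\<close>.\<close>
  define a where "a j k = (z - l j) * (l k - l j)\<^sup>2 * w j k - (z - l j)\<^sup>2 * (l k - l j) * w j k" for j k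
  \<comment> \<open>The product of the three differences changes sign under exchange of
    \<open>j\<close> and \<open>k\<close>, so the block over \<open>J\<close> cancels; it is
    nonnegative when \<open>l j < z \<le> l k\<close>.\<close>
  have a_alt: "a j k = (z - l j) * (l k - l j) * (l k - z) * w j k" for j k
    by (simp add: a_def power2_eq_square algebra_simps)
  have a_sums: "a j sums ((z - l j) * F j - (z - l j)\<^sup>2)" for j
    using sums_diff[OF sums_mult[OF F[of j], of "z - l j"] sums_mult[OF S[of j], of "(z - l j)\<^sup>2"]]
    by (simp add: a_def[abs_def] mult.assoc)
  have "(\<lambda>k. \<Sum>j\<in>J. a j k) sums (\<Sum>j\<in>J. (z - l j) * F j - (z - l j)\<^sup>2)"
    by (intro sums_sum a_sums)
  then have tot: "summable (\<lambda>k. \<Sum>j\<in>J. a j k)"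
      "(\<Sum>k. \<Sum>j\<in>J. a j k) = (\<Sum>j\<in>J. (z - l j) * F j - (z - l j)\<^sup>2)"
    by (auto simp: sums_iff)
  have "(\<Sum>k\<in>J. \<Sum>j\<in>J. a j k) = - (\<Sum>k\<in>J. \<Sum>j\<in>J. a k j)"
    unfolding sum_negf[symmetric]
    by (intro sum.cong refl) (simp add: a_alt sym algebra_simps)
  also have "(\<Sum>k\<in>J. \<Sum>j\<in>J. a k j) = (\<Sum>k\<in>J. \<Sum>j\<in>J. a j k)" by (rule sum.swap)
  finally have "(\<Sum>k\<in>J. \<Sum>j\<in>J. a j k) = 0" by simp
  moreover have "(\<Sum>k\<in>J. \<Sum>j\<in>J. a j k) \<le> (\<Sum>k. \<Sum>j\<in>J. a j k)"
  proof (rule sum_le_suminf[OF tot(1)])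
    show "finite J" using fin by (simp add: J_def)
    show "0 \<le> (\<Sum>j\<in>J. a j k)" if "k \<in> - J" for k
      using that nn by (intro sum_nonneg) (auto simp: a_alt J_def intro!: mult_nonneg_nonneg)
  qed
  ultimately show ?thesis using tot(2) by (simp add: sum_subtractf J_def)
qed

section \<open>Differentiability in the parameter\<close>

lemma real_analytic_on_differentiable:
  fixes f :: "real \<Rightarrow> real"
  assumes f: "real_analytic_on f S" and S: "open S" and t: "t \<in> S"
  shows "(f has_real_derivative deriv f t) (at t)"
proof -
  obtain r c where r: "r > 0"
    and sums: "\<And>s. s \<in> S \<Longrightarrow> \<bar>s - t\<bar> < r \<Longrightarrow> (\<lambda>n. (s - t) ^ n *\<^sub>R c n) sums f s"
    using f t unfolding real_analytic_on_def by blast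
  obtain q where q: "q > 0" "\<And>s. \<bar>s - t\<bar> < q \<Longrightarrow> s \<in> S"
    using S t unfolding open_dist by (metis dist_real_def)
  \<comment> \<open>The expansion is known only at points of \<open>S\<close>, so the radius shrinks
    until the whole interval around \<open>t\<close> lies in \<open>S\<close>.\<close>
  define p where "p = min r q"
  have p: "p > 0" using r q by (simp add: p_def)
  have sums': "(\<lambda>n. c n * (s - t) ^ n) sums f s" if "\<bar>s - t\<bar> < p" for s
    using sums[of s] q(2)[of s] that by (simp add: p_def mult.commute)
  have "((\<lambda>x. \<Sum>n. c n * x ^ n) has_real_derivative (\<Sum>n. diffs c n * 0 ^ n)) (at 0)"
  proof (rule termdiffs_strong)
    show "summable (\<lambda>n. c n * (p / 2) ^ n)"
      using sums'[of "t + p / 2"] p by (simp add: sums_iff)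
    show "norm (0::real) < norm (p / 2)" using p by simp
  qed
  then have "((\<lambda>s. \<Sum>n. c n * (s - t) ^ n) has_real_derivative (\<Sum>n. diffs c n * 0 ^ n)) (at t)"
    using DERIV_shift[of "\<lambda>x. \<Sum>n. c n * x ^ n" _ t "- t"] by simp
  then have "(f has_real_derivative (\<Sum>n. diffs c n * 0 ^ n)) (at t)"
    by (rule has_field_derivative_transform_within[OF _ p])
      (use sums' in \<open>auto simp: sums_iff dist_real_def\<close>)
  then show ?thesis by (metis DERIV_imp_deriv)
qed

text \<open>Squaring removes the kink of the positive part: at 0 the difference quotient is
  \<open>max h 0\<close> itself. Eigenvalues that cross the level \<open>z * B \<tau>\<close> thus
  do not disturb differentiation.\<close>

lemma has_real_derivative_max_0_power2:
  "((\<lambda>x::real. (max x 0)\<^sup>2) has_real_derivative 2 * max x 0) (at x)"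
proof -
  consider "x > 0" | "x < 0" | "x = 0" by linarith
  then show ?thesis
  proof cases
    case 1
    have "((\<lambda>x::real. x\<^sup>2) has_real_derivative 2 * max x 0) (at x)"
      using 1 by (auto intro!: derivative_eq_intros)
    then show ?thesis
      by (rule has_field_derivative_transform_within_open[of _ _ _ "{0<..}"]) (use 1 in auto)
  next
    case 2
    have "((\<lambda>x::real. 0) has_real_derivative 2 * max x 0) (at x)" using 2 by auto
    then show ?thesis
      by (rule has_field_derivative_transform_within_open[of _ _ _ "{..<0}"]) (use 2 in auto)
  next
    case 3
    have "((\<lambda>h::real. max h 0) \<longlongrightarrow> 0) (at 0)"
      by (auto intro!: tendsto_eq_intros)
    moreover have "\<forall>\<^sub>F h::real in at 0. max h 0 = (max (0 + h) 0)\<^sup>2 / h"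
      by (auto simp: eventually_at_filter max_def power2_eq_square)
    ultimately have "((\<lambda>h::real. (max (0 + h) 0)\<^sup>2 / h) \<longlongrightarrow> 0) (at 0)"
      by (rule Lim_transform_eventually)
    then show ?thesis using 3 by (simp add: DERIV_def)
  qed
qed

section \<open>Monotonicity of the Riesz mean\<close>

text \<open>All operator theory enters through \<open>nonneg\<close> and \<open>ineq\<close>. The
  former confines the sum on a compact interval to a fixed finite index set; the latter, taken at
  \<open>c = z * B \<tau>\<close>, gives the sign of the derivative of the finite sum.\<close>

lemma Riesz_mean_monotone:
  fixes l l' :: "nat \<Rightarrow> real \<Rightarrow> real" and \<eta> \<theta> A B :: "real \<Rightarrow> real" and z :: real
  assumes I: "is_interval I"
    and fin: "\<And>\<tau> c. \<tau> \<in> I \<Longrightarrow> finite {j. l j \<tau> < c}"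
    and l: "\<And>j \<tau>. \<tau> \<in> I \<Longrightarrow> (l j has_real_derivative l' j \<tau>) (at \<tau>)"
    and nonneg: "\<And>j \<tau>. \<tau> \<in> I \<Longrightarrow> 0 \<le> \<eta> \<tau> * l j \<tau> + \<theta> \<tau> * l' j \<tau>"
    and ineq: "\<And>\<tau> c. \<tau> \<in> I \<Longrightarrow> (\<Sum>j | l j \<tau> < c. (c - l j \<tau>)\<^sup>2)
      \<le> (\<Sum>j | l j \<tau> < c. (c - l j \<tau>) * (\<eta> \<tau> * l j \<tau> + \<theta> \<tau> * l' j \<tau>))"
    and \<theta>: "\<And>\<tau>. \<tau> \<in> I \<Longrightarrow> \<theta> \<tau> \<noteq> 0"
    and A: "\<And>\<tau>. \<tau> \<in> I \<Longrightarrow> A \<tau> > 0"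
      "\<And>\<tau>. \<tau> \<in> I \<Longrightarrow> (A has_real_derivative - ((1 + \<eta> \<tau>) / \<theta> \<tau>) * A \<tau>) (at \<tau>)"
    and B: "\<And>\<tau>. \<tau> \<in> I \<Longrightarrow> B \<tau> > 0"
      "\<And>\<tau>. \<tau> \<in> I \<Longrightarrow> (B has_real_derivative - (\<eta> \<tau> / \<theta> \<tau>) * B \<tau>) (at \<tau>)"
  defines "R \<equiv> \<lambda>\<tau>. 1 / (A \<tau>)\<^sup>2 * (\<Sum>j. (max (z * B \<tau> - l j \<tau>) 0)\<^sup>2)"
  shows Riesz_mean_antimono: "\<forall>\<tau>\<in>I. \<theta> \<tau> > 0 \<Longrightarrow> antimono_on I R"
    and Riesz_mean_mono: "\<forall>\<tau>\<in>I. \<theta> \<tau> < 0 \<Longrightarrow> mono_on I R"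
proof -
  have below_iff: "l j \<tau> < z * B \<tau> \<longleftrightarrow> l j \<tau> / B \<tau> < z" if "\<tau> \<in> I" for j \<tau>
    using B(1)[OF that] by (simp add: pos_divide_less_eq)
  \<comment> \<open>The equation for \<open>B\<close> is what makes the expression in
    \<open>nonneg\<close> the numerator, so the derivative has the sign of \<open>\<theta>\<close>
    or vanishes.\<close>
  have quotient_deriv: "((\<lambda>\<tau>. l j \<tau> / B \<tau>) has_real_derivative
      (\<eta> \<tau> * l j \<tau> + \<theta> \<tau> * l' j \<tau>) / (\<theta> \<tau> * B \<tau>)) (at \<tau>)" if "\<tau> \<in> I" for j \<tau>
    using B(1)[OF that] \<theta>[OF that]
    by (auto intro!: derivative_eq_intros l B that simp: field_simps)

  \<comment> \<open>Here \<open>J\<close> stays fixed while \<open>\<tau>\<close> varies, which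
    allows termwise differentiation.\<close>
  define \<Phi> where "\<Phi> J \<tau> = 1 / (A \<tau>)\<^sup>2 * (\<Sum>j\<in>J. (max (z * B \<tau> - l j \<tau>) 0)\<^sup>2)" for J \<tau>
  have R_eq: "R \<tau> = \<Phi> J \<tau>" if "finite J" "{j. l j \<tau> < z * B \<tau>} \<subseteq> J" for J \<tau>
  proof -
    have "(\<Sum>j. (max (z * B \<tau> - l j \<tau>) 0)\<^sup>2) = (\<Sum>j\<in>J. (max (z * B \<tau> - l j \<tau>) 0)\<^sup>2)"
    proof (rule suminf_finite[OF that(1)])
      fix j assume "j \<notin> J"
      then have "\<not> l j \<tau> < z * B \<tau>" using that(2) by blast
      then show "(max (z * B \<tau> - l j \<tau>) 0)\<^sup>2 = 0" by simp
    qed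
    then show ?thesis by (simp add: R_def \<Phi>_def)
  qed
  \<comment> \<open>Multiplying the derivative by \<open>\<theta> \<tau>\<close> treats both signs
    of \<open>\<theta>\<close> at once.\<close>
  have \<Phi>_deriv: "\<exists>D. (\<Phi> J has_real_derivative D) (at \<tau>) \<and> \<theta> \<tau> * D \<le> 0"
    if J: "finite J" "{j. l j \<tau> < z * B \<tau>} \<subseteq> J" and \<tau>: "\<tau> \<in> I" for J \<tau>
  proof -
    define m where "m j = max (z * B \<tau> - l j \<tau>) 0" for j
    define D where "D = 2 * ((1 + \<eta> \<tau>) / \<theta> \<tau>) / (A \<tau>)\<^sup>2 * (\<Sum>j\<in>J. (m j)\<^sup>2) +
      1 / (A \<tau>)\<^sup>2 * (\<Sum>j\<in>J. 2 * m j * (z * (- (\<eta> \<tau> / \<theta> \<tau>) * B \<tau>) - l' j \<tau>))"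
    have dA: "((\<lambda>\<tau>. 1 / (A \<tau>)\<^sup>2) has_real_derivative 2 * ((1 + \<eta> \<tau>) / \<theta> \<tau>) / (A \<tau>)\<^sup>2) (at \<tau>)"
      using A(1)[OF \<tau>] \<theta>[OF \<tau>]
      by (auto intro!: derivative_eq_intros A(2)[OF \<tau>] simp: field_simps power2_eq_square)
    have dm: "((\<lambda>\<tau>. (max (z * B \<tau> - l j \<tau>) 0)\<^sup>2) has_real_derivative
        2 * m j * (z * (- (\<eta> \<tau> / \<theta> \<tau>) * B \<tau>) - l' j \<tau>)) (at \<tau>)" for j
      unfolding m_def
      by (rule DERIV_chain2[OF has_real_derivative_max_0_power2])
        (intro DERIV_diff DERIV_cmult B(2) l \<tau>)
    have "((\<lambda>\<tau>. \<Sum>j\<in>J. (max (z * B \<tau> - l j \<tau>) 0)\<^sup>2) has_real_derivative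
        (\<Sum>j\<in>J. 2 * m j * (z * (- (\<eta> \<tau> / \<theta> \<tau>) * B \<tau>) - l' j \<tau>))) (at \<tau>)"
      by (rule DERIV_sum) (rule dm)
    from DERIV_mult[OF dA this] have "(\<Phi> J has_real_derivative D) (at \<tau>)"
      by (simp add: \<Phi>_def[abs_def] D_def m_def algebra_simps)
    moreover have "\<theta> \<tau> * D \<le> 0"
    proof -
      let ?F = "\<lambda>j. \<eta> \<tau> * l j \<tau> + \<theta> \<tau> * l' j \<tau>"
      \<comment> \<open>Where \<open>m j\<close> is nonzero,
        \<open>z * B \<tau> = m j + l j \<tau>\<close>; the part
        \<open>\<eta> \<tau> * (m j)\<close> of the bracket then cancels the surplus in the factor
        \<open>1 + \<eta> \<tau>\<close> contributed by \<open>A\<close>.\<close>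
      have term_eq: "(1 + \<eta> \<tau>) * (m j)\<^sup>2 - m j * (\<eta> \<tau> * (z * B \<tau>) + \<theta> \<tau> * l' j \<tau>)
          = (m j)\<^sup>2 - m j * ?F j" for j
        by (cases "l j \<tau> < z * B \<tau>") (auto simp: m_def max_def power2_eq_square algebra_simps)
      have "\<theta> \<tau> * (2 * m j * (z * (- (\<eta> \<tau> / \<theta> \<tau>) * B \<tau>) - l' j \<tau>))
          = - 2 * (m j * (\<eta> \<tau> * (z * B \<tau>) + \<theta> \<tau> * l' j \<tau>))" for j
        using \<theta>[OF \<tau>] by (simp add: field_simps)
      then have "\<theta> \<tau> * (\<Sum>j\<in>J. 2 * m j * (z * (- (\<eta> \<tau> / \<theta> \<tau>) * B \<tau>) - l' j \<tau>))
          = - 2 * (\<Sum>j\<in>J. m j * (\<eta> \<tau> * (z * B \<tau>) + \<theta> \<tau> * l' j \<tau>))"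
        by (simp only: sum_distrib_left)
      moreover have "\<theta> \<tau> * D = 2 / (A \<tau>)\<^sup>2 * ((1 + \<eta> \<tau>) * (\<Sum>j\<in>J. (m j)\<^sup>2)) +
          1 / (A \<tau>)\<^sup>2 * (\<theta> \<tau> * (\<Sum>j\<in>J. 2 * m j * (z * (- (\<eta> \<tau> / \<theta> \<tau>) * B \<tau>) - l' j \<tau>)))"
        unfolding D_def distrib_left using \<theta>[OF \<tau>] by simp
      ultimately have "\<theta> \<tau> * D = 2 / (A \<tau>)\<^sup>2 * ((1 + \<eta> \<tau>) * (\<Sum>j\<in>J. (m j)\<^sup>2)
          - (\<Sum>j\<in>J. m j * (\<eta> \<tau> * (z * B \<tau>) + \<theta> \<tau> * l' j \<tau>)))"
        by (simp add: right_diff_distrib)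
      then have "\<theta> \<tau> * D = 2 / (A \<tau>)\<^sup>2 *
          (\<Sum>j\<in>J. (1 + \<eta> \<tau>) * (m j)\<^sup>2 - m j * (\<eta> \<tau> * (z * B \<tau>) + \<theta> \<tau> * l' j \<tau>))"
        by (simp only: sum_distrib_left sum_subtractf)
      also have "\<dots> = 2 / (A \<tau>)\<^sup>2 * ((\<Sum>j\<in>J. (m j)\<^sup>2) - (\<Sum>j\<in>J. m j * ?F j))"
        by (simp only: term_eq sum_subtractf)
      also have "(\<Sum>j\<in>J. (m j)\<^sup>2) = (\<Sum>j | l j \<tau> < z * B \<tau>. (z * B \<tau> - l j \<tau>)\<^sup>2)"
        using J by (intro sum.mono_neutral_cong_right) (auto simp: m_def)
      also have "(\<Sum>j\<in>J. m j * ?F j) = (\<Sum>j | l j \<tau> < z * B \<tau>. (z * B \<tau> - l j \<tau>) * ?F j)"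
        using J by (intro sum.mono_neutral_cong_right) (auto simp: m_def)
      finally have "\<theta> \<tau> * D = 2 / (A \<tau>)\<^sup>2 * ((\<Sum>j | l j \<tau> < z * B \<tau>. (z * B \<tau> - l j \<tau>)\<^sup>2)
          - (\<Sum>j | l j \<tau> < z * B \<tau>. (z * B \<tau> - l j \<tau>) * ?F j))" .
      also have "\<dots> \<le> 0"
        by (rule mult_nonneg_nonpos) (use ineq[OF \<tau>] in auto)
      finally show ?thesis .
    qed
    ultimately show ?thesis by blast
  qed

  show "antimono_on I R" if pos: "\<forall>\<tau>\<in>I. \<theta> \<tau> > 0"
  proof (rule monotone_onI)
    fix s t assume st: "s \<in> I" "t \<in> I" "s \<le> t"
    have sub: "\<tau> \<in> I" if "s \<le> \<tau>" "\<tau> \<le> t" for \<tau>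
      by (rule mem_is_interval_1_I[OF I st(1,2) that])
    \<comment> \<open>For positive \<open>\<theta>\<close> the quotients \<open>l j / B\<close> are
      nondecreasing, so the left endpoint has the largest set of contributing indices.\<close>
    define J where "J = {j. l j s < z * B s}"
    have J: "{j. l j \<tau> < z * B \<tau>} \<subseteq> J" if \<tau>: "s \<le> \<tau>" "\<tau> \<le> t" for \<tau>
    proof -
      have "l j s / B s \<le> l j \<tau> / B \<tau>" for j
      proof (rule DERIV_nonneg_imp_nondecreasing[OF \<tau>(1)])
        fix x assume "s \<le> x" "x \<le> \<tau>"
        then have x: "x \<in> I" using \<tau> by (intro sub) linarith+
        have "\<theta> x * B x > 0" using pos B(1)[OF x] x by simp
        then show "\<exists>y. ((\<lambda>\<tau>. l j \<tau> / B \<tau>) has_real_derivative y) (at x) \<and> 0 \<le> y"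
          using quotient_deriv[OF x, of j] divide_nonneg_pos[OF nonneg[OF x, of j]] by blast
      qed
      then show ?thesis
        unfolding J_def below_iff[OF sub[OF \<tau>]] below_iff[OF st(1)]
        by (blast intro: le_less_trans)
    qed
    have fJ: "finite J" using fin[OF st(1)] by (simp add: J_def)
    have "\<Phi> J t \<le> \<Phi> J s"
    proof (rule DERIV_nonpos_imp_nonincreasing[OF st(3)])
      fix x assume x: "s \<le> x" "x \<le> t"
      have "\<theta> x > 0" using pos sub[OF x] by blast
      then have "D \<le> 0" if "\<theta> x * D \<le> 0" for D using that by (simp add: mult_le_0_iff)
      then show "\<exists>y. (\<Phi> J has_real_derivative y) (at x) \<and> y \<le> 0"
        using \<Phi>_deriv[OF fJ J[OF x] sub[OF x]] by blast
    qed
    then show "R t \<le> R s" using R_eq[OF fJ J[OF order_refl st(3)]] R_eq[OF fJ J[OF st(3) order_refl]] by simp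
  qed

  show "mono_on I R" if neg: "\<forall>\<tau>\<in>I. \<theta> \<tau> < 0"
  proof (rule monotone_onI)
    fix s t assume st: "s \<in> I" "t \<in> I" "s \<le> t"
    have sub: "\<tau> \<in> I" if "s \<le> \<tau>" "\<tau> \<le> t" for \<tau>
      by (rule mem_is_interval_1_I[OF I st(1,2) that])
    \<comment> \<open>For negative \<open>\<theta>\<close> the quotients are nonincreasing and the
      right endpoint takes over.\<close>
    define J where "J = {j. l j t < z * B t}"
    have J: "{j. l j \<tau> < z * B \<tau>} \<subseteq> J" if \<tau>: "s \<le> \<tau>" "\<tau> \<le> t" for \<tau>
    proof -
      have "l j t / B t \<le> l j \<tau> / B \<tau>" for j
      proof (rule DERIV_nonpos_imp_nonincreasing[OF \<tau>(2)])
        fix x assume "\<tau> \<le> x" "x \<le> t"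
        then have x: "x \<in> I" using \<tau> by (intro sub) linarith+
        have "\<theta> x * B x < 0" using neg B(1)[OF x] x by (simp add: mult_neg_pos)
        then show "\<exists>y. ((\<lambda>\<tau>. l j \<tau> / B \<tau>) has_real_derivative y) (at x) \<and> y \<le> 0"
          using quotient_deriv[OF x, of j] divide_nonneg_neg[OF nonneg[OF x, of j]] by blast
      qed
      then show ?thesis
        unfolding J_def below_iff[OF sub[OF \<tau>]] below_iff[OF st(2)]
        by (blast intro: le_less_trans)
    qed
    have fJ: "finite J" using fin[OF st(2)] by (simp add: J_def)
    have "\<Phi> J s \<le> \<Phi> J t"
    proof (rule DERIV_nonneg_imp_nondecreasing[OF st(3)])
      fix x assume x: "s \<le> x" "x \<le> t"
      have "\<theta> x < 0" using neg sub[OF x] by blast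
      then have "0 \<le> D" if "\<theta> x * D \<le> 0" for D using that by (simp add: mult_le_0_iff)
      then show "\<exists>y. (\<Phi> J has_real_derivative y) (at x) \<and> 0 \<le> y"
        using \<Phi>_deriv[OF fJ J[OF x] sub[OF x]] by blast
    qed
    then show "R s \<le> R t" using R_eq[OF fJ J[OF order_refl st(3)]] R_eq[OF fJ J[OF st(3) order_refl]] by simp
  qed
qed

section \<open>From the commutator hypotheses to the weights\<close>

theorem theorem1p1:
  fixes I :: "real set"
    and H :: "real \<Rightarrow> 'a::chilbert_space lop"
    and D :: "'a set"
    and lam :: "nat \<Rightarrow> real \<Rightarrow> real"
    and u :: "nat \<Rightarrow> real \<Rightarrow> 'a"
    and d :: nat
    and G :: "nat \<Rightarrow> 'a lop"
    and \<eta> \<theta> A B :: "real \<Rightarrow> real"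
  assumes I: "open I" "is_interval I"
    and H: "analytic_family_common_domain H D I"
    and discrete: "\<And>\<tau>. \<tau> \<in> I \<Longrightarrow> purely_discrete_spectrum (H \<tau>)"
    and spectrum: "\<And>\<tau>. \<tau> \<in> I \<Longrightarrow> op_spectrum (H \<tau>) = range (\<lambda>j. complex_of_real (lam j \<tau>))"
    and bounded_below: "\<And>\<tau>. \<tau> \<in> I \<Longrightarrow> bdd_below (range (\<lambda>j. lam j \<tau>))"
    and accumulate: "\<And>\<tau> c. \<tau> \<in> I \<Longrightarrow> finite {j. lam j \<tau> \<le> c}"
    and lam_analytic: "\<And>j. real_analytic_on (lam j) I"
    and eigenvector: "\<And>\<tau> j. \<tau> \<in> I \<Longrightarrow>
          u j \<tau> \<in> D \<and> op_app (H \<tau>) (u j \<tau>) = complex_of_real (lam j \<tau>) *\<^sub>C u j \<tau>"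
    and basis: "\<And>\<tau>. \<tau> \<in> I \<Longrightarrow> complete_orthonormal (\<lambda>j. u j \<tau>)"
    and G: "\<And>\<alpha>. \<alpha> \<in> {1..d} \<Longrightarrow> linear_op (G \<alpha>) \<and> densely_defined (G \<alpha>)"
    and commutators: "\<And>\<alpha> \<tau> j. \<alpha> \<in> {1..d} \<Longrightarrow> \<tau> \<in> I \<Longrightarrow>
          commutators_defined_at (H \<tau>) (G \<alpha>) (u j \<tau>)"
    and second_commutators: "\<And>\<tau> j. \<tau> \<in> I \<Longrightarrow>
          1 / 2 * (\<Sum>\<alpha>=1..d.
             cinner (op_app (commutator (op_adjoint (G \<alpha>)) (commutator (H \<tau>) (G \<alpha>))) (u j \<tau>)) (u j \<tau>) +
             cinner (op_app (commutator (G \<alpha>) (commutator (H \<tau>) (op_adjoint (G \<alpha>)))) (u j \<tau>)) (u j \<tau>))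
          = 1"
    and first_commutators: "\<And>\<tau> j. \<tau> \<in> I \<Longrightarrow>
          (\<Sum>\<alpha>=1..d.
             Re (cinner (op_app (commutator (H \<tau>) (G \<alpha>)) (u j \<tau>))
                        (op_app (commutator (H \<tau>) (G \<alpha>)) (u j \<tau>))) +
             Re (cinner (op_app (commutator (H \<tau>) (op_adjoint (G \<alpha>))) (u j \<tau>))
                        (op_app (commutator (H \<tau>) (op_adjoint (G \<alpha>))) (u j \<tau>))))
          \<le> \<eta> \<tau> * lam j \<tau> + \<theta> \<tau> * deriv (lam j) \<tau>"
    and \<eta>: "continuous_on I \<eta>" "\<And>\<tau>. \<tau> \<in> I \<Longrightarrow> 1 + \<eta> \<tau> > 0"
    and \<theta>: "continuous_on I \<theta>" "\<And>\<tau>. \<tau> \<in> I \<Longrightarrow> \<theta> \<tau> \<noteq> 0"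
    and A: "\<And>\<tau>. \<tau> \<in> I \<Longrightarrow> A \<tau> > 0"
      "\<And>\<tau>. \<tau> \<in> I \<Longrightarrow> (A has_real_derivative - ((1 + \<eta> \<tau>) / \<theta> \<tau>) * A \<tau>) (at \<tau>)"
    and B: "\<And>\<tau>. \<tau> \<in> I \<Longrightarrow> B \<tau> > 0"
      "\<And>\<tau>. \<tau> \<in> I \<Longrightarrow> (B has_real_derivative - (\<eta> \<tau> / \<theta> \<tau>) * B \<tau>) (at \<tau>)"
  shows "\<forall>z::real.
    ((\<forall>\<tau>\<in>I. \<theta> \<tau> > 0) \<longrightarrow>
       antimono_on I (\<lambda>\<tau>. 1 / (A \<tau>)\<^sup>2 * (\<Sum>j. (max (z * B \<tau> - lam j \<tau>) 0)\<^sup>2))) \<and>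
    ((\<forall>\<tau>\<in>I. \<theta> \<tau> < 0) \<longrightarrow>
       mono_on I (\<lambda>\<tau>. 1 / (A \<tau>)\<^sup>2 * (\<Sum>j. (max (z * B \<tau> - lam j \<tau>) 0)\<^sup>2)))"
proof -
  have self_adj: "self_adjoint (H \<tau>)" and dom_H: "op_dom (H \<tau>) = D" if "\<tau> \<in> I" for \<tau>
    using H that by (auto simp: analytic_family_common_domain_def)
  have trace: "(\<Sum>j | lam j \<tau> < c. (c - lam j \<tau>)\<^sup>2)
      \<le> (\<Sum>j | lam j \<tau> < c. (c - lam j \<tau>) * (\<eta> \<tau> * lam j \<tau> + \<theta> \<tau> * deriv (lam j) \<tau>))"
    and nonneg: "0 \<le> \<eta> \<tau> * lam i \<tau> + \<theta> \<tau> * deriv (lam i) \<tau>" if \<tau>: "\<tau> \<in> I" for \<tau> c i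
  proof -
    let ?e = "\<lambda>j. u j \<tau>" and ?l = "\<lambda>j. lam j \<tau>" and ?G' = "\<lambda>\<alpha>. op_adjoint (G \<alpha>)"
    let ?C = "\<lambda>\<alpha>. commutator (H \<tau>) (G \<alpha>)" and ?C' = "\<lambda>\<alpha>. commutator (H \<tau>) (?G' \<alpha>)"
    define g where "g \<alpha> j k = (cmod (cinner (op_app (G \<alpha>) (?e j)) (?e k)))\<^sup>2" for \<alpha> j k
    define g' where "g' \<alpha> j k = (cmod (cinner (op_app (?G' \<alpha>) (?e j)) (?e k)))\<^sup>2" for \<alpha> j k
    define w where "w j k = (\<Sum>\<alpha>=1..d. g \<alpha> j k + g' \<alpha> j k)" for j k
    define F where "F j = (\<Sum>\<alpha>=1..d.
        Re (cinner (op_app (?C \<alpha>) (?e j)) (op_app (?C \<alpha>) (?e j))) +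
        Re (cinner (op_app (?C' \<alpha>) (?e j)) (op_app (?C' \<alpha>) (?e j))))" for j
    note symH = self_adjoint_cinner[OF self_adj[OF \<tau>]]
    note eig = eigenvector[OF \<tau>, folded dom_H[OF \<tau>]]
    have dense: "densely_defined (G \<alpha>)" if "\<alpha> \<in> {1..d}" for \<alpha> using G[OF that] by simp
    have dom: "?e j \<in> op_dom (commutator (?G' \<alpha>) (?C \<alpha>))"
        "?e j \<in> op_dom (commutator (G \<alpha>) (?C' \<alpha>))"
      if "\<alpha> \<in> {1..d}" for \<alpha> j
      using commutators[OF that \<tau>, of j] by (auto simp: commutators_defined_at_def)
    have adj: "cinner (op_app (G \<alpha>) x) y = cinner x (op_app (?G' \<alpha>) y)"
        "cinner (op_app (?G' \<alpha>) y) x = cinner y (op_app (G \<alpha>) x)"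
      if "\<alpha> \<in> {1..d}" "x \<in> op_dom (G \<alpha>)" "y \<in> op_dom (?G' \<alpha>)" for \<alpha> x y
    \<comment> \<open>Conjugating the adjoint relation lets \<open>G \<alpha>\<close> act as the
      partner of \<open>?G' \<alpha>\<close> on the domains at hand.\<close>
    proof -
      show *: "cinner (op_app (G \<alpha>) x) y = cinner x (op_app (?G' \<alpha>) y)"
        by (rule op_adjoint_cinner[OF dense[OF that(1)] that(2,3)])
      show "cinner (op_app (?G' \<alpha>) y) x = cinner y (op_app (G \<alpha>) x)"
        using arg_cong[OF *, of cnj] unfolding cinner_commute[symmetric] by (rule sym)
    qed
    have hom: "op_app (G \<alpha>) (complex_of_real (?l j) *\<^sub>C ?e j) = complex_of_real (?l j) *\<^sub>C op_app (G \<alpha>) (?e j)"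
        "op_app (?G' \<alpha>) (complex_of_real (?l j) *\<^sub>C ?e j) = complex_of_real (?l j) *\<^sub>C op_app (?G' \<alpha>) (?e j)"
      if \<alpha>: "\<alpha> \<in> {1..d}" for \<alpha> j
    proof -
      show "op_app (G \<alpha>) (complex_of_real (?l j) *\<^sub>C ?e j) = complex_of_real (?l j) *\<^sub>C op_app (G \<alpha>) (?e j)"
        using G[OF \<alpha>] dom(1)[OF \<alpha>, of j] by (simp add: linear_op_def op_dom_commutator)
      \<comment> \<open>The second membership concerns the multiple of \<open>?e j\<close> by its
        eigenvalue, as \<open>op_adjoint_scaleC\<close> requires.\<close>
      have "?e j \<in> op_dom (?G' \<alpha>)" "op_app (H \<tau>) (?e j) \<in> op_dom (?G' \<alpha>)"
        using dom(2)[OF \<alpha>, of j] by (auto simp: op_dom_commutator)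
      then show "op_app (?G' \<alpha>) (complex_of_real (?l j) *\<^sub>C ?e j) = complex_of_real (?l j) *\<^sub>C op_app (?G' \<alpha>) (?e j)"
        using op_adjoint_scaleC[OF dense[OF \<alpha>]] eig[of j] by simp
    qed
    have sums:
      "(\<lambda>k. (?l k - ?l j)\<^sup>2 * g \<alpha> j k) sums Re (cinner (op_app (?C \<alpha>) (?e j)) (op_app (?C \<alpha>) (?e j)))"
      "(\<lambda>k. (?l k - ?l j)\<^sup>2 * g' \<alpha> j k) sums Re (cinner (op_app (?C' \<alpha>) (?e j)) (op_app (?C' \<alpha>) (?e j)))"
      "(\<lambda>k. (?l k - ?l j) * (g \<alpha> j k + g' \<alpha> j k))
        sums Re (cinner (op_app (commutator (?G' \<alpha>) (?C \<alpha>)) (?e j)) (?e j))"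
      "(\<lambda>k. (?l k - ?l j) * (g' \<alpha> j k + g \<alpha> j k))
        sums Re (cinner (op_app (commutator (G \<alpha>) (?C' \<alpha>)) (?e j)) (?e j))"
      if \<alpha>: "\<alpha> \<in> {1..d}" for \<alpha> j
    proof -
      note H_facts = symH basis[OF \<tau>] conjunct1[OF eig] conjunct2[OF eig]
      note G_sums = commutator_sums[where H = "H \<tau>" and X = "G \<alpha>" and Y = "?G' \<alpha>" and e = ?e and l = ?l and j = j, OF H_facts adj(1)[OF \<alpha>] hom(1)[OF \<alpha>] dom(1)[OF \<alpha>]]
      note G'_sums = commutator_sums[where H = "H \<tau>" and X = "?G' \<alpha>" and Y = "G \<alpha>" and e = ?e and l = ?l and j = j, OF H_facts adj(2)[OF \<alpha>] hom(2)[OF \<alpha>] dom(2)[OF \<alpha>]]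
      show "(\<lambda>k. (?l k - ?l j)\<^sup>2 * g \<alpha> j k)
          sums Re (cinner (op_app (?C \<alpha>) (?e j)) (op_app (?C \<alpha>) (?e j)))"
        unfolding g_def by (rule G_sums(1))
      show "(\<lambda>k. (?l k - ?l j)\<^sup>2 * g' \<alpha> j k)
          sums Re (cinner (op_app (?C' \<alpha>) (?e j)) (op_app (?C' \<alpha>) (?e j)))"
        unfolding g'_def by (rule G'_sums(1))
      show "(\<lambda>k. (?l k - ?l j) * (g \<alpha> j k + g' \<alpha> j k))
          sums Re (cinner (op_app (commutator (?G' \<alpha>) (?C \<alpha>)) (?e j)) (?e j))"
        unfolding g_def g'_def by (rule G_sums(2))
      show "(\<lambda>k. (?l k - ?l j) * (g' \<alpha> j k + g \<alpha> j k))
          sums Re (cinner (op_app (commutator (G \<alpha>) (?C' \<alpha>)) (?e j)) (?e j))"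
        unfolding g_def g'_def by (rule G'_sums(2))
    qed
    \<comment> \<open>The matrix of the adjoint in the eigenbasis is the conjugate transpose, so the
      squared moduli are transposed; this makes \<open>w\<close> symmetric.\<close>
    have g'_eq: "g' \<alpha> j k = g \<alpha> k j" if \<alpha>: "\<alpha> \<in> {1..d}" for \<alpha> j k
    proof -
      have "cinner (op_app (?G' \<alpha>) (?e j)) (?e k) = cnj (cinner (op_app (G \<alpha>) (?e k)) (?e j))"
        using adj(2)[OF \<alpha>, of "?e k" "?e j"] dom[OF \<alpha>, of j] dom[OF \<alpha>, of k]
          cinner_commute[of "?e j" "op_app (G \<alpha>) (?e k)"]
        by (simp add: op_dom_commutator)
      then show ?thesis by (simp add: g_def g'_def)
    qed
    have F_sums: "(\<lambda>k. (?l k - ?l j)\<^sup>2 * w j k) sums F j" for j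
    proof -
      have "(\<lambda>k. \<Sum>\<alpha>=1..d. (?l k - ?l j)\<^sup>2 * g \<alpha> j k + (?l k - ?l j)\<^sup>2 * g' \<alpha> j k) sums F j"
        unfolding F_def by (intro sums_sum sums_add sums)
      then show ?thesis by (simp add: w_def sum_distrib_left distrib_left)
    qed
    have S_sums: "(\<lambda>k. (?l k - ?l j) * w j k) sums 1" for j
    proof -
      \<comment> \<open>Both second commutators produce the same series, so the factor 1/2 in the
        hypothesis leaves exactly one copy of \<open>w\<close>.\<close>
      have "(\<lambda>k. \<Sum>\<alpha>=1..d. (?l k - ?l j) * (g \<alpha> j k + g' \<alpha> j k) + (?l k - ?l j) * (g' \<alpha> j k + g \<alpha> j k))
        sums (\<Sum>\<alpha>=1..d. Re (cinner (op_app (commutator (?G' \<alpha>) (?C \<alpha>)) (?e j)) (?e j)) +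
          Re (cinner (op_app (commutator (G \<alpha>) (?C' \<alpha>)) (?e j)) (?e j)))" (is "_ sums ?s")
        by (intro sums_sum sums_add sums)
      moreover have "1 / 2 * ?s = 1"
        using arg_cong[OF second_commutators[OF \<tau>, of j], of Re] by simp
      ultimately have "(\<lambda>k. 1 / 2 * (\<Sum>\<alpha>=1..d. (?l k - ?l j) * (g \<alpha> j k + g' \<alpha> j k) + (?l k - ?l j) * (g' \<alpha> j k + g \<alpha> j k))) sums 1"
        using sums_mult[of _ ?s "1 / 2"] by simp
      moreover have "(?l k - ?l j) * (g \<alpha> j k + g' \<alpha> j k) + (?l k - ?l j) * (g' \<alpha> j k + g \<alpha> j k)
          = 2 * ((?l k - ?l j) * (g \<alpha> j k + g' \<alpha> j k))" for \<alpha> k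
        by (simp add: algebra_simps)
      ultimately show ?thesis by (simp add: w_def sum_distrib_left)
    qed
    have F_le: "F j \<le> \<eta> \<tau> * ?l j + \<theta> \<tau> * deriv (lam j) \<tau>" for j
      unfolding F_def by (rule first_commutators[OF \<tau>])
    have w_nonneg: "w j k \<ge> 0" for j k
      by (simp add: w_def g_def g'_def sum_nonneg)
    have "w j k = w k j" for j k
      unfolding w_def by (intro sum.cong refl) (simp add: g'_eq)
    moreover have "finite {j. ?l j < c}"
      by (rule finite_subset[OF _ accumulate[OF \<tau>, of c]]) auto
    ultimately have "(\<Sum>j | ?l j < c. (c - ?l j)\<^sup>2) \<le> (\<Sum>j | ?l j < c. (c - ?l j) * F j)"
      by (intro symmetric_weights_trace_inequality[of _ _ w] w_nonneg S_sums F_sums)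
    also have "\<dots> \<le> (\<Sum>j | ?l j < c. (c - ?l j) * (\<eta> \<tau> * ?l j + \<theta> \<tau> * deriv (lam j) \<tau>))"
      by (intro sum_mono mult_left_mono F_le) auto
    finally show "(\<Sum>j | ?l j < c. (c - ?l j)\<^sup>2)
      \<le> (\<Sum>j | ?l j < c. (c - ?l j) * (\<eta> \<tau> * ?l j + \<theta> \<tau> * deriv (lam j) \<tau>))" .
    \<comment> \<open>A sum of squares bounds the right-hand side of the first commutator hypothesis
      from below, which later orders the quotients of \<open>lam i\<close> by
      \<open>B\<close>.\<close>
    have "0 \<le> F i"
      by (rule sums_le[OF _ sums_zero F_sums]) (simp add: w_nonneg)
    also note F_le
    finally show "0 \<le> \<eta> \<tau> * ?l i + \<theta> \<tau> * deriv (lam i) \<tau>" .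
  qed
  have fin: "finite {j. lam j \<tau> < c}" if "\<tau> \<in> I" for \<tau> c
    by (rule finite_subset[OF _ accumulate[OF that, of c]]) auto
  note mono = Riesz_mean_monotone[OF I(2) fin
      real_analytic_on_differentiable[OF lam_analytic I(1)] nonneg trace \<theta>(2) A B]
  show ?thesis by (intro allI conjI impI mono)
qed

end
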